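(* Let $q$ be a prime power. For every integer $h\ge 2$ we have $n_q(\lfloor 2.5h\rfloor,h;2)\ge q^h+2$.
   Context: All dimensions are vector-space dimensions; a hyperplane of $\mathbb{F}_q^r$ is an $(r-1)$-dimensional subspace. A projective $h-(n,r,s)_q$ system is a multiset of $n$ subspaces of $\mathbb{F}_q^r$, each of dimension at most $h$, such that each hyperplane contains at most $s$ of these subspaces (counted with multiplicity) and some hyperplane contains exactly $s$ of them. $n_q(r,h;s)$ denotes the maximum $n$ such that a projective $h-(n,r,s)_q$ system exists. *)

theory Defs
  imports
    Complex_Main
    "HOL-Library.Multiset"
    "HOL-Library.Function_Algebras"
    "HOL-Library.Cardinality"
    "HOL-Number_Theory.Prime_Powers"
begin

definition fscale :: "'a::field \<Rightarrow> (nat \<Rightarrow> 'a) \<Rightarrow> (nat \<Rightarrow> 'a)" where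
  "fscale c v = (\<lambda>i. c * v i)"

global_interpretation fvec: vector_space "fscale :: 'a::field \<Rightarrow> (nat \<Rightarrow> 'a) \<Rightarrow> (nat \<Rightarrow> 'a)"
  by unfold_locales (auto simp: fscale_def fun_eq_iff algebra_simps)

text \<open>
  The \<open>r\<close>-dimensional space over the field \<open>'a\<close>: the coordinates are indexed by
  \<open>0, \<dots>, r - 1\<close> and all entries beyond them are \<open>0\<close>.
\<close>

definition coord_space :: "nat \<Rightarrow> (nat \<Rightarrow> 'a::field) set" where
  "coord_space r = {v. \<forall>i\<ge>r. v i = 0}"

definition is_subspace :: "nat \<Rightarrow> (nat \<Rightarrow> 'a::field) set \<Rightarrow> bool" where
  "is_subspace r U \<longleftrightarrow> fvec.subspace U \<and> U \<subseteq> coord_space r"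

definition is_hyperplane :: "nat \<Rightarrow> (nat \<Rightarrow> 'a::field) set \<Rightarrow> bool" where
  "is_hyperplane r H \<longleftrightarrow> is_subspace r H \<and> fvec.dim H + 1 = r"

definition contained_count :: "(nat \<Rightarrow> 'a) set multiset \<Rightarrow> (nat \<Rightarrow> 'a) set \<Rightarrow> nat" where
  "contained_count M H = size {#U \<in># M. U \<subseteq> H#}"

definition projective_system ::
  "nat \<Rightarrow> nat \<Rightarrow> nat \<Rightarrow> nat \<Rightarrow> (nat \<Rightarrow> 'a::{field,finite}) set multiset \<Rightarrow> bool" where
  "projective_system h n r s M \<longleftrightarrow>
     size M = n \<and>
     (\<forall>U\<in>#M. is_subspace r U \<and> fvec.dim U \<le> h) \<and>
     (\<forall>H. is_hyperplane r H \<longrightarrow> contained_count M H \<le> s) \<and>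
     (\<exists>H. is_hyperplane r H \<and> contained_count M H = s)"

text \<open>
  The number \<open>n\<^sub>q(r, h; s)\<close>, where the field with \<open>q\<close> elements is passed as a type.
  The maximum is meaningful if the set is finite and nonempty. It is finite if \<open>h < r\<close>:
  every member of a system then lies in one of the finitely many hyperplanes, and each
  of these contains at most \<open>s\<close> members.
\<close>

definition n_max :: "'a::{field,finite} itself \<Rightarrow> nat \<Rightarrow> nat \<Rightarrow> nat \<Rightarrow> nat" where
  "n_max _ r h s =
     Max {n. \<exists>M :: (nat \<Rightarrow> 'a) set multiset. projective_system h n r s M}"

end

(*
  Let K be the field with q^h elements and m = h div 2, so that floor (2.5 h) = 2 h + m.
  The points (1 : x : x^2) of a conic over K, taken as h-dimensional subspaces
  {(s, s x, s x^2) | s in K} of K^3, are q^h subspaces any three of which span K^3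
  (Vandermonde), and this survives dropping all but m coordinates of the last component.
  In place of the conic's point at infinity, the shorter last component leaves room for two
  further h-dimensional subspaces: both have first component 0 and contain the whole last
  component, and the remaining parts, each of dimension h - m >= h / 2, together fill
  the middle component. Any three members of the resulting family of q^h + 2 subspaces span,
  so no hyperplane contains three of them.
*)

theory Submission
  imports Defs "HOL-Algebra.Algebraic_Closure_Type" "HOL-Number_Theory.Residues"
begin

section \<open>Coordinate subspaces\<close>

definition coord_subspace :: "nat set \<Rightarrow> (nat \<Rightarrow> 'a::field) set" where
  "coord_subspace J = {v. \<forall>i. i \<notin> J \<longrightarrow> v i = 0}"

definition unit_vec :: "nat \<Rightarrow> nat \<Rightarrow> 'a::field" where
  "unit_vec i = (\<lambda>j. if j = i then 1 else 0)"

lemma coord_space_eq_coord_subspace: "coord_space r = coord_subspace {..<r}"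
  by (auto simp: coord_space_def coord_subspace_def not_less)

lemma subspace_coord_subspace: "fvec.subspace (coord_subspace J)"
  by (rule fvec.subspaceI) (auto simp: coord_subspace_def fscale_def)

lemma coord_subspace_mono: "I \<subseteq> J \<Longrightarrow> coord_subspace I \<subseteq> coord_subspace J"
  by (auto simp: coord_subspace_def)

text \<open>Split a vector into its entries on \<open>I\<close> and the rest, which is supported on
  \<open>J\<close>; the two parts add up to it.\<close>

lemma coord_subspace_Un_subset:
  assumes "fvec.subspace H" "coord_subspace I \<subseteq> H" "coord_subspace J \<subseteq> H"
  shows "coord_subspace (I \<union> J) \<subseteq> H"
proof
  fix v :: "nat \<Rightarrow> 'a"
  assume v: "v \<in> coord_subspace (I \<union> J)"
  let ?a = "\<lambda>i. if i \<in> I then v i else 0" and ?b = "\<lambda>i. if i \<in> I then 0 else v i"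
  have "?a \<in> H" "?b \<in> H"
    using v assms(2,3) by (auto simp: coord_subspace_def)
  then have "?a + ?b \<in> H"
    by (rule fvec.subspace_add[OF assms(1)])
  also have "?a + ?b = v"
    by (auto simp: fun_eq_iff)
  finally show "v \<in> H" .
qed

lemma inj_unit_vec: "inj (unit_vec :: nat \<Rightarrow> nat \<Rightarrow> 'a::field)"
  by (auto simp: inj_def unit_vec_def fun_eq_iff split: if_splits)

lemma span_unit_vec_subset: "fvec.span (unit_vec ` J) \<subseteq> coord_subspace J"
  by (rule fvec.span_minimal[OF _ subspace_coord_subspace])
     (auto simp: coord_subspace_def unit_vec_def)

text \<open>All vectors in the span of the other unit vectors vanish at position \<open>i\<close>,
  whereas \<open>unit_vec i\<close> does not.\<close>

lemma independent_unit_vec: "fvec.independent (unit_vec ` J :: (nat \<Rightarrow> 'a::field) set)"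
proof
  assume "fvec.dependent (unit_vec ` J :: (nat \<Rightarrow> 'a) set)"
  then obtain i where i: "i \<in> J" "unit_vec i \<in> fvec.span (unit_vec ` J - {unit_vec i :: nat \<Rightarrow> 'a})"
    by (auto simp: fvec.dependent_def)
  have eq: "unit_vec ` J - {unit_vec i :: nat \<Rightarrow> 'a} = unit_vec ` (J - {i})"
    using inj_unit_vec[where 'a = 'a] by (auto simp: inj_def)
  have "(unit_vec i :: nat \<Rightarrow> 'a) \<in> coord_subspace (J - {i})"
    using i(2) unfolding eq by (rule subsetD[OF span_unit_vec_subset])
  then show False
    by (auto simp: coord_subspace_def unit_vec_def)
qed

lemma span_unit_vec:
  assumes "finite J"
  shows "fvec.span (unit_vec ` J :: (nat \<Rightarrow> 'a::field) set) = coord_subspace J"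
proof
  show "coord_subspace J \<subseteq> fvec.span (unit_vec ` J :: (nat \<Rightarrow> 'a) set)"
    using assms
  proof (induction J)
    case empty
    then show ?case
      by (auto simp: coord_subspace_def fun_eq_iff)
  next
    case (insert i J)
    have "coord_subspace {i} \<subseteq> fvec.span (unit_vec ` insert i J :: (nat \<Rightarrow> 'a) set)"
    proof
      fix v :: "nat \<Rightarrow> 'a"
      assume "v \<in> coord_subspace {i}"
      then have "v = fscale (v i) (unit_vec i)"
        by (auto simp: coord_subspace_def unit_vec_def fscale_def fun_eq_iff)
      also have "\<dots> \<in> fvec.span (unit_vec ` insert i J)"
        by (intro fvec.span_scale fvec.span_base) auto
      finally show "v \<in> fvec.span (unit_vec ` insert i J)" .
    qed
    moreover have "coord_subspace J \<subseteq> fvec.span (unit_vec ` insert i J :: (nat \<Rightarrow> 'a) set)"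
      using insert.IH fvec.span_mono[of "unit_vec ` J" "unit_vec ` insert i J"] by blast
    ultimately show ?case
      using coord_subspace_Un_subset[OF fvec.subspace_span] by (metis insert_is_Un)
  qed
qed (rule span_unit_vec_subset)

lemma dim_coord_subspace:
  assumes "finite J"
  shows "fvec.dim (coord_subspace J :: (nat \<Rightarrow> 'a::field) set) = card J"
proof -
  have "fvec.dim (coord_subspace J :: (nat \<Rightarrow> 'a) set) = card (unit_vec ` J :: (nat \<Rightarrow> 'a) set)"
    by (rule fvec.dim_eq_card[OF _ independent_unit_vec])
       (simp add: span_unit_vec[OF assms] fvec.span_eq_iff[THEN iffD2, OF subspace_coord_subspace])
  then show ?thesis
    by (simp add: card_image inj_on_subset[OF inj_unit_vec])
qed

lemma bij_betw_restrict_coord_space: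
  "bij_betw (\<lambda>v. restrict v {..<n}) (coord_space n) ({..<n} \<rightarrow>\<^sub>E (UNIV :: 'a::field set))"
  by (rule bij_betw_byWitness[where f' = "\<lambda>v i. if i < n then v i else 0"])
     (auto simp: coord_space_def fun_eq_iff PiE_def extensional_def)

lemma finite_coord_space: "finite (coord_space n :: (nat \<Rightarrow> 'a::{field,finite}) set)"
  using bij_betw_finite[OF bij_betw_restrict_coord_space[of n, where 'a = 'a]]
  by (simp add: finite_PiE)

lemma card_coord_space: "card (coord_space n :: (nat \<Rightarrow> 'a::{field,finite}) set) = CARD('a) ^ n"
  using bij_betw_same_card[OF bij_betw_restrict_coord_space[of n, where 'a = 'a]]
  by (simp add: card_PiE)

section \<open>Hyperplanes and the maximum\<close>

lemma hyperplane_not_superset: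
  assumes "is_hyperplane r H"
  shows "\<not> coord_space r \<subseteq> H"
proof
  assume "coord_space r \<subseteq> H"
  with assms have "H = coord_space r"
    by (auto simp: is_hyperplane_def is_subspace_def)
  with assms show False
    by (simp add: is_hyperplane_def coord_space_eq_coord_subspace dim_coord_subspace)
qed

text \<open>Extend a basis of \<open>U\<close> to a basis of the whole space. Since \<open>U\<close>
  is proper, some basis vector was added, and the remaining ones span a hyperplane that still
  contains \<open>U\<close>.\<close>

lemma subspace_in_hyperplane:
  fixes U :: "(nat \<Rightarrow> 'a::field) set"
  assumes "is_subspace r U" "fvec.dim U < r"
  obtains H where "is_hyperplane r H" "U \<subseteq> H"
proof -
  obtain B where B: "B \<subseteq> U" "fvec.independent B" "U \<subseteq> fvec.span B" "card B = fvec.dim U"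
    by (rule fvec.basis_exists)
  have "B \<subseteq> coord_space r"
    using B(1) assms(1) by (auto simp: is_subspace_def)
  then obtain C where C: "B \<subseteq> C" "C \<subseteq> coord_space r" "fvec.independent C"
      "coord_space r \<subseteq> fvec.span C"
    using fvec.maximal_independent_subset_extend B(2) by metis
  have cardC: "card C = r"
    using fvec.basis_card_eq_dim[OF C(2,4,3)]
    by (simp add: coord_space_eq_coord_subspace dim_coord_subspace)
  \<comment> \<open>An infinite \<open>C\<close> would have \<open>card C = 0\<close>, but
    \<open>r\<close> is positive.\<close>
  with assms(2) have finC: "finite C"
    by (metis card.infinite not_less_zero)
  have "B \<noteq> C"
    using B(4) cardC assms(2) by auto
  then obtain c where c: "c \<in> C" "c \<notin> B"
    using C(1) by blast
  let ?H = "fvec.span (C - {c})"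
  show thesis
  proof
    have "?H \<subseteq> coord_space r"
      using C(2) unfolding coord_space_eq_coord_subspace
      by (intro fvec.span_minimal subspace_coord_subspace) auto
    moreover have "fvec.dim ?H = card (C - {c})"
      by (rule fvec.dim_span_eq_card_independent) (rule fvec.independent_mono[OF C(3)], blast)
    ultimately show "is_hyperplane r ?H"
      using c(1) finC cardC assms(2) by (simp add: is_hyperplane_def is_subspace_def fvec.subspace_span)
    show "U \<subseteq> ?H"
      using B(3) fvec.span_mono[of B "C - {c}"] C(1) c(2) by blast
  qed
qed

text \<open>A crude bound whose purpose is to make the set under \<open>Max\<close> in
  \<open>n_max\<close> finite. Each member lies in a hyperplane because \<open>h < r\<close>, so its
  multiplicity is at most \<open>s\<close>, and there are only finitely many candidates for
  members.\<close>

lemma projective_system_size_le: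
  fixes M :: "(nat \<Rightarrow> 'a::{field,finite}) set multiset"
  assumes "projective_system h n r s M" "h < r"
  shows "n \<le> s * card (Pow (coord_space r :: (nat \<Rightarrow> 'a) set))"
proof -
  let ?P = "Pow (coord_space r :: (nat \<Rightarrow> 'a) set)"
  have sub: "set_mset M \<subseteq> ?P"
    using assms(1) by (auto simp: projective_system_def is_subspace_def)
  have "count M U \<le> s" for U
  proof (cases "U \<in># M")
    case True
    then have "is_subspace r U" "fvec.dim U < r"
      using assms by (auto simp: projective_system_def dest: le_less_trans)
    then obtain H where H: "is_hyperplane r H" "U \<subseteq> H"
      by (rule subspace_in_hyperplane)
    have "count M U = count {#V \<in># M. V \<subseteq> H#} U"
      using H(2) by simp
    also have "\<dots> \<le> contained_count M H"
      unfolding contained_count_def by (rule count_le_size)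
    also have "\<dots> \<le> s"
      using assms(1) H(1) by (simp add: projective_system_def)
    finally show ?thesis .
  qed (simp add: not_in_iff)
  then have "(\<Sum>U\<in>set_mset M. count M U) \<le> (\<Sum>U\<in>set_mset M. s)"
    by (intro sum_mono)
  also have "\<dots> \<le> s * card ?P"
    using card_mono[OF _ sub] by (simp add: finite_coord_space mult.commute)
  finally show ?thesis
    using assms(1) by (simp add: projective_system_def size_multiset_overloaded_eq)
qed

lemma n_max_ge:
  fixes M :: "(nat \<Rightarrow> 'a::{field,finite}) set multiset"
  assumes "projective_system h n r s M" "h < r"
  shows "n \<le> n_max TYPE('a) r h s"
  unfolding n_max_def
proof (rule Max_ge)
  show "finite {n. \<exists>M :: (nat \<Rightarrow> 'a) set multiset. projective_system h n r s M}"
    by (rule finite_subset[of _ "{..s * card (Pow (coord_space r :: (nat \<Rightarrow> 'a) set))}"])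
       (use projective_system_size_le[OF _ assms(2)] in auto)
qed (use assms(1) in blast)

text \<open>Reduces the hyperplane condition to a spanning property of triples. Counting indices
  instead of subspaces accounts for multiplicities.\<close>

lemma contained_count_image_mset_set_le_2:
  assumes "finite I" "is_hyperplane r H"
    and span: "\<And>i j k. \<lbrakk>i \<in> I; j \<in> I; k \<in> I; i \<noteq> j; i \<noteq> k; j \<noteq> k; fvec.subspace H;
      U i \<subseteq> H; U j \<subseteq> H; U k \<subseteq> H\<rbrakk> \<Longrightarrow> coord_space r \<subseteq> H"
  shows "contained_count (image_mset U (mset_set I)) H \<le> 2"
proof (rule ccontr)
  let ?J = "{i \<in> I. U i \<subseteq> H}"
  assume "\<not> ?thesis"
  moreover have "contained_count (image_mset U (mset_set I)) H = card ?J"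
    using assms(1) by (simp add: contained_count_def filter_mset_image_mset)
  ultimately have "3 \<le> card ?J"
    by simp
  then obtain T where T: "T \<subseteq> ?J" "card T = 3"
    by (rule obtain_subset_with_card_n)
  obtain i j k where ijk: "T = {i, j, k}" "i \<noteq> j" "i \<noteq> k" "j \<noteq> k"
    using T(2) unfolding card_3_iff by blast
  with T(1) have "i \<in> ?J" "j \<in> ?J" "k \<in> ?J"
    by simp_all
  with ijk(2-4) have "coord_space r \<subseteq> H"
    using span[of i j k] assms(2) by (auto simp: is_hyperplane_def is_subspace_def)
  with hyperplane_not_superset[OF assms(2)] show False ..
qed

section \<open>The extension field of degree \<open>h\<close>\<close>

text \<open>Multiplication by a nonzero \<open>x\<close> permutes the nonzero elements, so comparing
  their products before and after gives \<open>x ^ (CARD('a) - 1) = 1\<close>.\<close>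

lemma power_card_eq_same:
  fixes x :: "'a::{field,finite}"
  shows "x ^ CARD('a) = x"
proof (cases "x = 0")
  case False
  have "x ^ (CARD('a) - 1) * \<Prod>(UNIV - {0}) = (\<Prod>y\<in>UNIV - {0}. x * y)"
    by (simp add: prod.distrib)
  also have "\<dots> = \<Prod>(UNIV - {0})"
    by (rule prod.reindex_bij_witness[of _ "\<lambda>y. y / x" "\<lambda>y. x * y"]) (use False in auto)
  finally have "x ^ (CARD('a) - 1) = 1"
    by simp
  then have "x * x ^ (CARD('a) - 1) = x"
    by simp
  then show ?thesis
    by (metis power_eq_if zero_less_card_finite less_numeral_extra(3))
qed (simp add: zero_power)

text \<open>The characteristic is a prime dividing the prime power \<open>CARD('a)\<close>, hence it
  is its base. This form of the cardinality is what the freshman's dream requires.\<close>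

lemma CARD_eq_CHAR_power:
  assumes "primepow CARD('a::{field,finite})"
  obtains k where "k > 0" "CARD('a) = CHAR('a) ^ k" "Factorial_Ring.prime CHAR('a)"
proof -
  have pr: "Factorial_Ring.prime CHAR('a)"
    by (rule prime_CHAR_semidom) (simp add: finite_imp_CHAR_pos)
  from assms obtain p k where pk: "Factorial_Ring.prime p" "k > 0" "CARD('a) = p ^ k"
    by (auto simp: primepow_def)
  have "CHAR('a) dvd p ^ k"
    using CHAR_dvd_CARD[where 'a = 'a] pk(3) by simp
  then have "CHAR('a) = p"
    using pr pk(1) by (meson prime_dvd_power primes_dvd_imp_eq)
  with pk pr that show thesis
    by blast
qed

text \<open>The polynomial \<open>x\<^sup>n - x\<close> is separable because its derivative is the constant \<open>-1\<close>.\<close>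

lemma card_power_fixpoints:
  fixes n :: nat
  assumes "of_nat n = (0 :: 'a::alg_closed_field)" "n > 1"
  shows "card {x :: 'a. x ^ n = x} = n"
proof -
  define P where "P = Polynomial.monom 1 n - [:0, 1 :: 'a:]"
  have deg: "degree P = n"
    unfolding P_def using assms(2)
    by (subst diff_conv_add_uminus, subst degree_add_eq_left) (auto simp: Polynomial.degree_monom_eq)
  have poly_P: "poly P x = x ^ n - x" for x
    by (simp add: P_def poly_monom)
  have P0: "P \<noteq> 0"
    using deg assms(2) by auto
  have pd: "pderiv P = [:-1:]"
    using assms(1) by (simp add: P_def pderiv_diff pderiv_monom pderiv_pCons)
  have order1: "Polynomial.order x P = 1" if "poly P x = 0" for x
  proof -
    have "\<not> [:-x, 1:] ^ 2 dvd P"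
    proof
      assume "[:-x, 1:] ^ 2 dvd P"
      then obtain R where "P = [:-x, 1:] ^ 2 * R" ..
      moreover define L where "L = [:-x, 1:]"
      ultimately have "P = L * (L * R)" "poly L x = 0"
        by (simp_all only: power2_eq_square mult.assoc) simp
      \<comment> \<open>A double root is also a root of the derivative: both terms of the product
        rule keep a factor \<open>L\<close>.\<close>
      then have "poly (pderiv P) x = 0"
        by (simp add: pderiv_mult)
      then show False
        by (simp add: pd)
    qed
    then have "Polynomial.order x P < 2"
      using P0 by (simp add: order_divides)
    with that P0 show ?thesis
      using order_root[of P x] by simp
  qed
  \<comment> \<open>Over an algebraically closed field \<open>P\<close> splits, so it has
    \<open>n\<close> roots with multiplicity; as every root is simple, there are \<open>n\<close>
    distinct ones.\<close>
  obtain A where A: "size A = degree P" "P = smult (lead_coeff P) (\<Prod>x\<in>#A. [:-x, 1:])"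
    using alg_closed_imp_factorization[OF P0] by blast
  have "proots (\<Prod>x\<in>#A. [:-x, 1:]) = A"
    by (induction A) (simp_all add: proots_mult prod_mset_zero_iff image_iff del: mult_pCons_left)
  then have "proots P = A"
    using P0 by (subst A(2)) simp
  then have "n = size (proots P)"
    using A(1) deg by simp
  also have "\<dots> = (\<Sum>x | poly P x = 0. Polynomial.order x P)"
    using P0 by (simp add: size_multiset_overloaded_eq)
  also have "\<dots> = card {x. poly P x = 0}"
    using order1 by simp
  finally show ?thesis
    by (simp add: poly_P)
qed


text \<open>Raising to a power of the characteristic is additive as well as multiplicative, so its
  fixed points form a subfield.\<close>

lemma subfield_power_fixpoints:
  fixes x y :: "'b::field"
  assumes "Factorial_Ring.prime CHAR('b)" "n = CHAR('b) ^ k" "n > 0"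
    and "x ^ n = x" "y ^ n = y"
  shows "(x + y) ^ n = x + y" "(x * y) ^ n = x * y" "inverse x ^ n = inverse x"
  using assms freshmans_dream'[of n k x y] by (simp_all add: power_mult_distrib power_inverse)

text \<open>The extension field is a subset \<open>K\<close> of a bigger field since its degree
  \<open>h\<close> is a variable, on which no type can depend. The map \<open>e\<close> embeds the
  ground field, and \<open>\<psi>\<close> is a linear coordinate isomorphism. Recording
  \<open>e (-1) = -1\<close> makes \<open>K\<close> closed under negation.\<close>

locale coordinatized_field =
  fixes K :: "'b::field set" and e :: "'a::{field,finite} \<Rightarrow> 'b"
    and \<psi> :: "'b \<Rightarrow> nat \<Rightarrow> 'a" and h :: nat
  assumes add_closed: "\<lbrakk>x \<in> K; y \<in> K\<rbrakk> \<Longrightarrow> x + y \<in> K"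
    and mult_closed: "\<lbrakk>x \<in> K; y \<in> K\<rbrakk> \<Longrightarrow> x * y \<in> K"
    and inverse_closed: "x \<in> K \<Longrightarrow> inverse x \<in> K"
    and e_closed: "e c \<in> K"
    and e_uminus_1: "e (-1) = -1"
    and \<psi>_add: "\<lbrakk>x \<in> K; y \<in> K\<rbrakk> \<Longrightarrow> \<psi> (x + y) = \<psi> x + \<psi> y"
    and \<psi>_scale: "x \<in> K \<Longrightarrow> \<psi> (e c * x) = fscale c (\<psi> x)"
    and bij_\<psi>: "bij_betw \<psi> K (coord_space h)"

text \<open>Take the fixed points of \<open>x ^ Q\<close> in the algebraic closure of the ground
  field. A basis over the ground field supplies the coordinates, and counting shows that it has
  \<open>h\<close> elements.\<close>

lemma ex_coordinatized_field:
  assumes "primepow CARD('a::{field,finite})" "h > 0"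
  obtains K and \<psi> :: "'a::{field,finite} alg_closure \<Rightarrow> nat \<Rightarrow> 'a"
  where "coordinatized_field K to_ac \<psi> h" "card K = CARD('a) ^ h"
proof -
  define Q where "Q = CARD('a) ^ h"
  define K where "K = {x :: 'a alg_closure. x ^ Q = x}"
  obtain k where k: "k > 0" "CARD('a) = CHAR('a) ^ k" and pr: "Factorial_Ring.prime CHAR('a)"
    using CARD_eq_CHAR_power[OF assms(1)] by metis
  have Q: "Q = CHAR('a alg_closure) ^ (k * h)"
    by (simp add: Q_def k(2) power_mult)
  have pr': "Factorial_Ring.prime CHAR('a alg_closure)"
    using pr by simp
  have "CARD('a) > 1"
    using assms(1) primepow_gt_Suc_0 by fastforce
  then have "Q > 1"
    using assms(2) unfolding Q_def by (rule one_less_power)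
  have "CHAR('a alg_closure) dvd Q"
    unfolding Q using k(1) assms(2) by (intro dvd_power) auto
  then have "of_nat Q = (0 :: 'a alg_closure)"
    by (simp only: of_nat_eq_0_iff_char_dvd)
  then have cardK: "card K = Q"
    unfolding K_def using \<open>Q > 1\<close> by (rule card_power_fixpoints)
  then have "finite K"
    using \<open>Q > 1\<close> by (metis card.infinite not_one_less_zero)
  have K_add: "x + y \<in> K" and K_mult: "x * y \<in> K" and K_inverse: "inverse x \<in> K"
    if "x \<in> K" "y \<in> K" for x y
    using subfield_power_fixpoints[OF pr' Q] \<open>Q > 1\<close> that by (simp_all add: K_def)
  \<comment> \<open>Iterating \<open>c ^ CARD('a) = c\<close> shows that the ground field lies in
    \<open>K\<close>.\<close>
  have "c ^ Q = c" for c :: 'a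
    unfolding Q_def by (induction h) (simp_all add: power_card_eq_same power_mult)
  then have K_to_ac: "to_ac c \<in> K" for c
    by (simp add: K_def flip: to_ac_power)

  interpret ac: vector_space "\<lambda>c (x :: 'a alg_closure). to_ac c * x"
    by unfold_locales (simp_all add: algebra_simps)
  have subK: "ac.subspace K"
    using K_to_ac[of 0] by (intro ac.subspaceI) (auto intro: K_add K_mult K_to_ac)
  obtain B where B: "B \<subseteq> K" "ac.independent B" "K \<subseteq> ac.span B"
    by (rule ac.maximal_independent_subset)
  have spanB: "ac.span B = K"
    using ac.span_minimal[OF B(1) subK] B(3) by blast
  have finB: "finite B"
    using B(1) \<open>finite K\<close> by (rule finite_subset)
  obtain b where b: "bij_betw b {..<card B} B"
    using ex_bij_betw_nat_finite[OF finB] by (auto simp: atLeast0LessThan)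
  define \<psi> where "\<psi> x = (\<lambda>i. if i < card B then ac.representation B x (b i) else 0)" for x
  have \<psi>_add: "\<psi> (x + y) = \<psi> x + \<psi> y" if "x \<in> K" "y \<in> K" for x y
    using that B(2) by (auto simp: \<psi>_def fun_eq_iff ac.representation_add spanB)
  have \<psi>_scale: "\<psi> (to_ac c * x) = fscale c (\<psi> x)" if "x \<in> K" for c x
    using that B(2) by (auto simp: \<psi>_def fun_eq_iff fscale_def ac.representation_scale spanB)
  have "bij_betw \<psi> K (coord_space (card B))"
  proof (rule bij_betw_byWitness[where f' = "\<lambda>v. \<Sum>i<card B. to_ac (v i) * b i"])
    have reindex: "(\<Sum>i<card B. f (b i)) = sum f B" for f :: "_ \<Rightarrow> 'a alg_closure"
      by (rule sum.reindex_bij_betw[OF b])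
    show "\<forall>x\<in>K. (\<Sum>i<card B. to_ac (\<psi> x i) * b i) = x"
      using reindex[of "\<lambda>y. to_ac (ac.representation B _ y) * y"]
        ac.sum_representation_eq[OF B(2) _ finB order_refl]
      by (simp add: \<psi>_def spanB)
    show "\<psi> ` K \<subseteq> coord_space (card B)"
      by (auto simp: \<psi>_def coord_space_def)
    show "(\<lambda>v. \<Sum>i<card B. to_ac (v i) * b i) ` coord_space (card B) \<subseteq> K"
      using B(1) bij_betwE[OF b]
      by (auto intro!: ac.subspace_sum[OF subK] K_mult K_to_ac)
    show "\<forall>v\<in>coord_space (card B). \<psi> (\<Sum>i<card B. to_ac (v i) * b i) = v"
    proof
      fix v :: "nat \<Rightarrow> 'a"
      assume v: "v \<in> coord_space (card B)"
      \<comment> \<open>The coefficients \<open>v\<close> are moved from positions to basis vectors,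
        so that the sum runs over \<open>B\<close> and \<open>ac.representation\<close>
        applies.\<close>
      define g where "g y = v (the_inv_into {..<card B} b y)" for y
      have g: "g (b i) = v i" if "i < card B" for i
        using that b by (simp add: g_def the_inv_into_f_f bij_betw_def)
      have "(\<Sum>i<card B. to_ac (v i) * b i) = (\<Sum>y\<in>B. to_ac (g y) * y)"
        using reindex[of "\<lambda>y. to_ac (g y) * y"] by (simp add: g)
      moreover have "ac.representation B (\<Sum>y\<in>B. to_ac (g y) * y) (b i) = v i" if "i < card B" for i
      proof -
        have bi: "b i \<in> B"
          using that bij_betwE[OF b] by auto
        have "ac.representation B (\<Sum>y\<in>B. to_ac (g y) * y) (b i)
            = (\<Sum>y\<in>B. ac.representation B (to_ac (g y) * y) (b i))"
          using B(2) by (subst ac.representation_sum) (auto intro: ac.span_scale ac.span_base)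
        also have "\<dots> = (\<Sum>y\<in>B. if y = b i then g y else 0)"
          using B(2) by (intro sum.cong)
            (auto simp: ac.representation_scale ac.span_base ac.representation_basis)
        also have "\<dots> = v i"
          using bi finB g[OF that] by simp
        finally show ?thesis .
      qed
      ultimately show "\<psi> (\<Sum>i<card B. to_ac (v i) * b i) = v"
        using v by (auto simp: \<psi>_def fun_eq_iff coord_space_def)
    qed
  qed
  \<comment> \<open>Both sides count \<open>K\<close>: once through the coordinates, once as the
    root set.\<close>
  moreover from bij_betw_same_card[OF this] have "CARD('a) ^ card B = CARD('a) ^ h"
    by (simp add: card_coord_space cardK Q_def)
  then have "card B = h"
    using \<open>CARD('a) > 1\<close> by simp
  ultimately have "coordinatized_field K to_ac \<psi> h"
    by unfold_locales (auto intro: K_add K_mult K_inverse K_to_ac \<psi>_add \<psi>_scale)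
  with cardK that show thesis
    by (simp add: Q_def)
qed


section \<open>The projective system\<close>

context coordinatized_field
begin

section \<open>Arithmetic in \<open>K\<close> and coordinates of \<open>K^3\<close> with shortened
  last component\<close>

lemma uminus_closed: "x \<in> K \<Longrightarrow> - x \<in> K"
  using mult_closed[OF e_closed[of "-1"]] by (simp add: e_uminus_1)

lemma diff_closed: "\<lbrakk>x \<in> K; y \<in> K\<rbrakk> \<Longrightarrow> x - y \<in> K"
  using add_closed[OF _ uminus_closed, of x y] by simp

lemma divide_closed: "\<lbrakk>x \<in> K; y \<in> K\<rbrakk> \<Longrightarrow> x / y \<in> K"
  using mult_closed[OF _ inverse_closed, of x y] by (simp add: divide_inverse)

lemma zero_closed: "0 \<in> K"
  using diff_closed[OF e_closed[of 0] e_closed[of 0]] by simp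

lemmas closed = add_closed mult_closed diff_closed divide_closed

lemma \<psi>_in_coord_space: "x \<in> K \<Longrightarrow> \<psi> x \<in> coord_space h"
  using bij_\<psi> by (auto simp: bij_betw_def)

lemma ex_\<psi>_eq: "v \<in> coord_space h \<Longrightarrow> \<exists>x\<in>K. \<psi> x = v"
  using bij_\<psi> by (metis bij_betw_imp_surj_on imageE)

text \<open>Truncating the last component is linear, so spanning identities in \<open>K^3\<close>
  carry over. In return, different \<open>u\<close> may give the same vector.\<close>

definition join :: "'b \<Rightarrow> 'b \<Rightarrow> 'b \<Rightarrow> nat \<Rightarrow> 'a" where
  "join s t u = (\<lambda>i. if i < h then \<psi> s i else if i < 2 * h then \<psi> t (i - h)
     else if i < 2 * h + h div 2 then \<psi> u (i - 2 * h) else 0)"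

lemma join_add:
  "\<lbrakk>s \<in> K; t \<in> K; u \<in> K; s' \<in> K; t' \<in> K; u' \<in> K\<rbrakk> \<Longrightarrow>
    join (s + s') (t + t') (u + u') = join s t u + join s' t' u'"
  by (auto simp: join_def fun_eq_iff \<psi>_add)

lemma join_scale:
  "\<lbrakk>s \<in> K; t \<in> K; u \<in> K\<rbrakk> \<Longrightarrow> join (e c * s) (e c * t) (e c * u) = fscale c (join s t u)"
  by (auto simp: join_def fun_eq_iff \<psi>_scale fscale_def)

lemma \<psi>_0: "\<psi> 0 = 0"
  using \<psi>_add[OF zero_closed zero_closed] by simp

lemma join_0: "join 0 0 0 = 0"
  by (auto simp: join_def fun_eq_iff \<psi>_0)

lemma join_in_coord_space: "join s t u \<in> coord_space (2 * h + h div 2)"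
  by (auto simp: join_def coord_space_def)

lemma join_0_in_coord_subspace: "join 0 t u \<in> coord_subspace {h..<2 * h + h div 2}"
  by (auto simp: join_def coord_subspace_def \<psi>_0)

lemma join_0_0_in_coord_subspace: "join 0 0 u \<in> coord_subspace {2 * h..<2 * h + h div 2}"
  by (auto simp: join_def coord_subspace_def \<psi>_0)

text \<open>Lifts an arbitrary vector to \<open>K^3\<close>, where the spanning arguments can solve
  equations over the field.\<close>

lemma ex_join_eq:
  assumes "v \<in> coord_space (2 * h + h div 2)"
  shows "\<exists>s\<in>K. \<exists>t\<in>K. \<exists>u\<in>K. v = join s t u"
proof -
  define a b c where
    "a = (\<lambda>i. if i < h then v i else 0)"
    and "b = (\<lambda>i. if i < h then v (h + i) else 0)"
    and "c = (\<lambda>i. if i < h then v (2 * h + i) else 0)"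
  have "a \<in> coord_space h" "b \<in> coord_space h" "c \<in> coord_space h"
    by (simp_all add: a_def b_def c_def coord_space_def)
  then obtain s t u where stu: "s \<in> K" "t \<in> K" "u \<in> K" "\<psi> s = a" "\<psi> t = b" "\<psi> u = c"
    using ex_\<psi>_eq by meson
  have "v = join s t u"
    using assms by (auto simp: fun_eq_iff join_def stu(4-6) a_def b_def c_def coord_space_def)
  with stu(1-3) show ?thesis
    by blast
qed

section \<open>Conic points as subspaces, and what they span\<close>

definition conic_member :: "'b \<Rightarrow> (nat \<Rightarrow> 'a) set" where
  "conic_member x = (\<lambda>s. join s (s * x) (s * x\<^sup>2)) ` K"

lemma join_in_conic_member: "s \<in> K \<Longrightarrow> join s (s * x) (s * x\<^sup>2) \<in> conic_member x"
  by (auto simp: conic_member_def)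

lemma join_decompose_conic:
  assumes "s \<in> K" "t \<in> K" "u \<in> K" "x \<in> K"
  shows "join s t u = join s (s * x) (s * x\<^sup>2) + join 0 (t - s * x) (u - s * x\<^sup>2)"
  using join_add[of s "s * x" "s * x\<^sup>2" 0 "t - s * x" "u - s * x\<^sup>2"] assms
  by (simp add: closed zero_closed power2_eq_square)

lemma subspace_conic_member:
  assumes "x \<in> K"
  shows "fvec.subspace (conic_member x)"
proof (rule fvec.subspaceI)
  show "0 \<in> conic_member x"
    using join_in_conic_member[OF zero_closed, of x] by (simp add: join_0)
next
  fix v w
  assume "v \<in> conic_member x" "w \<in> conic_member x"
  then obtain s s' where s: "s \<in> K" "s' \<in> K"
      "v = join s (s * x) (s * x\<^sup>2)" "w = join s' (s' * x) (s' * x\<^sup>2)"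
    by (auto simp: conic_member_def)
  then have "v + w = join (s + s') ((s + s') * x) ((s + s') * x\<^sup>2)"
    using assms by (simp add: closed join_add distrib_right power2_eq_square)
  then show "v + w \<in> conic_member x"
    using s by (simp add: closed join_in_conic_member)
next
  fix c v
  assume "v \<in> conic_member x"
  then obtain s where s: "s \<in> K" "v = join s (s * x) (s * x\<^sup>2)"
    by (auto simp: conic_member_def)
  then have "fscale c v = join (e c * s) (e c * s * x) (e c * s * x\<^sup>2)"
    using assms by (simp add: join_scale[symmetric] closed power2_eq_square mult.assoc)
  then show "fscale c v \<in> conic_member x"
    using s by (simp add: closed e_closed join_in_conic_member)
qed

text \<open>The first \<open>h\<close> entries of a vector of the member are
  \<open>\<psi> s\<close>, which determines \<open>s\<close> and thus the vector. Projection to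
  these entries is therefore injective and linear on the member.\<close>

lemma dim_conic_member:
  assumes "x \<in> K"
  shows "fvec.dim (conic_member x) \<le> h"
proof -
  obtain B where B: "B \<subseteq> conic_member x" "fvec.independent B" "conic_member x \<subseteq> fvec.span B"
      "card B = fvec.dim (conic_member x)"
    by (rule fvec.basis_exists)
  let ?head = "\<lambda>v i. if i < h then v i else (0::'a)"
  interpret head: Vector_Spaces.linear "fscale :: 'a \<Rightarrow> _" fscale ?head
    by unfold_locales (auto simp: fscale_def fun_eq_iff)
  have "inj_on ?head (conic_member x)"
  proof (rule inj_onI)
    fix v w
    assume "v \<in> conic_member x" "w \<in> conic_member x"
    then obtain s t where st: "s \<in> K" "t \<in> K" "v = join s (s * x) (s * x\<^sup>2)" "w = join t (t * x) (t * x\<^sup>2)"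
      by (auto simp: conic_member_def)
    assume "?head v = ?head w"
    then have "\<psi> s i = \<psi> t i" if "i < h" for i
      using that by (auto simp: st join_def fun_eq_iff split: if_splits)
    \<comment> \<open>Both coordinate vectors are padded with \<open>0\<close> from position
      \<open>h\<close> on.\<close>
    moreover have "\<psi> s i = \<psi> t i" if "\<not> i < h" for i
      using that st(1,2)[THEN \<psi>_in_coord_space] by (simp add: coord_space_def)
    ultimately have "\<psi> s = \<psi> t"
      by blast
    then have "s = t"
      using bij_\<psi> st(1,2) by (auto simp: bij_betw_def dest: inj_onD)
    then show "v = w"
      by (simp add: st)
  qed
  moreover have "fvec.span B \<subseteq> conic_member x"
    by (rule fvec.span_minimal[OF B(1) subspace_conic_member[OF assms]])
  ultimately have inj: "inj_on ?head (fvec.span B)"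
    by (rule inj_on_subset)
  have "card B = card (?head ` B)"
    using inj fvec.span_superset by (metis card_image inj_on_subset)
  also have "\<dots> = fvec.dim (?head ` B)"
    by (rule fvec.dim_eq_card_independent[symmetric]) (rule head.independent_inj_on_image[OF B(2) inj])
  also have "\<dots> \<le> card (unit_vec ` {..<h} :: (nat \<Rightarrow> 'a) set)"
    by (rule fvec.dim_le_card) (auto simp: span_unit_vec coord_subspace_def)
  also have "\<dots> \<le> h"
    using card_image_le[of "{..<h}" unit_vec] by simp
  finally show ?thesis
    by (simp add: B(4))
qed

text \<open>Solves the Vandermonde system with nodes \<open>x\<close>, \<open>y\<close>,
  \<open>z\<close> for the multipliers \<open>a\<close>, \<open>b\<close>, \<open>c\<close> of the
  three conic points.\<close>

lemma three_conic_members_span: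
  assumes H: "fvec.subspace H" and x: "x \<in> K" "y \<in> K" "z \<in> K" "x \<noteq> y" "x \<noteq> z" "y \<noteq> z"
    and sub: "conic_member x \<subseteq> H" "conic_member y \<subseteq> H" "conic_member z \<subseteq> H"
  shows "coord_space (2 * h + h div 2) \<subseteq> H"
proof
  fix v :: "nat \<Rightarrow> 'a"
  assume "v \<in> coord_space (2 * h + h div 2)"
  then obtain s t u where stu: "s \<in> K" "t \<in> K" "u \<in> K" "v = join s t u"
    using ex_join_eq by blast
  \<comment> \<open>The functional \<open>u - (y + z) * t + y * z * s\<close> takes the value
    \<open>(w - y) * (w - z)\<close> at \<open>(1, w, w^2)\<close>. It kills the points of
    \<open>y\<close> and \<open>z\<close> and so isolates \<open>a\<close>.\<close>
  define a where "a = (u - (y + z) * t + y * z * s) / ((x - y) * (x - z))"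
  define s' where "s' = s - a"
  \<comment> \<open>What remains is \<open>b + c = s'\<close> and
    \<open>b * y + c * z = t - a * x\<close>; subtracting \<open>z\<close> times the first equation
    leaves \<open>b * (y - z)\<close>.\<close>
  define b where "b = ((t - a * x) - z * s') / (y - z)"
  define c where "c = s' - b"
  have K: "a \<in> K" "s' \<in> K" "b \<in> K" "c \<in> K"
    using x(1-3) stu(1-3) by (simp_all add: a_def s'_def b_def c_def closed)
  have ne: "x - y \<noteq> 0" "x - z \<noteq> 0" "y - z \<noteq> 0"
    using x by auto
  have s: "s = a + (b + c)"
    by (simp add: c_def s'_def)
  have b: "b * (y - z) = (t - a * x) - z * s'"
    using ne by (simp add: b_def)
  have a: "a * ((x - y) * (x - z)) = u - (y + z) * t + y * z * s"
    using ne by (simp add: a_def)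
  have t: "t = a * x + (b * y + c * z)"
    using b by (simp add: c_def algebra_simps)
  have u: "u = a * x\<^sup>2 + (b * y\<^sup>2 + c * z\<^sup>2)"
    using a unfolding t s by (simp add: algebra_simps power2_eq_square)
  have "v = join a (a * x) (a * x\<^sup>2) + (join b (b * y) (b * y\<^sup>2) + join c (c * z) (c * z\<^sup>2))"
    unfolding stu(4) s t u using K x(1-3) by (simp add: join_add closed power2_eq_square)
  also have "\<dots> \<in> H"
    using join_in_conic_member K sub by (intro fvec.subspace_add[OF H]) blast+
  finally show "v \<in> H" .
qed

text \<open>Two conic points can match the first two components, by a Vandermonde system of size
  two. The error in the last component is absorbed by the coordinate subspace.\<close>

lemma two_conic_members_span:
  assumes H: "fvec.subspace H" and x: "x \<in> K" "y \<in> K" "x \<noteq> y"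
    and sub: "conic_member x \<subseteq> H" "conic_member y \<subseteq> H"
      "coord_subspace {2 * h..<2 * h + h div 2} \<subseteq> H"
  shows "coord_space (2 * h + h div 2) \<subseteq> H"
proof
  fix v :: "nat \<Rightarrow> 'a"
  assume "v \<in> coord_space (2 * h + h div 2)"
  then obtain s t u where stu: "s \<in> K" "t \<in> K" "u \<in> K" "v = join s t u"
    using ex_join_eq by blast
  define a where "a = (t - y * s) / (x - y)"
  define b where "b = s - a"
  define c where "c = u - (a * x\<^sup>2 + b * y\<^sup>2)"
  have K: "a \<in> K" "b \<in> K" "c \<in> K"
    using x(1,2) stu(1-3) by (simp_all add: a_def b_def c_def closed power2_eq_square)
  \<comment> \<open>The summand \<open>0\<close> lets \<open>join_add\<close> split off the third
    vector \<open>join 0 0 c\<close>.\<close>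
  have s: "s = a + (b + 0)"
    by (simp add: b_def)
  have "a * (x - y) = t - y * s"
    using x(3) by (simp add: a_def)
  then have t: "t = a * x + (b * y + 0)"
    by (simp add: b_def algebra_simps)
  have u: "u = a * x\<^sup>2 + (b * y\<^sup>2 + c)"
    by (simp add: c_def)
  have "v = join a (a * x) (a * x\<^sup>2) + (join b (b * y) (b * y\<^sup>2) + join 0 0 c)"
    unfolding stu(4) s t u using K x(1,2)
    by (simp only: join_add closed zero_closed power2_eq_square)
  also have "\<dots> \<in> H"
    using join_in_conic_member join_0_0_in_coord_subspace K sub
    by (intro fvec.subspace_add[OF H]) blast+
  finally show "v \<in> H" .
qed

lemma one_conic_member_span:
  assumes H: "fvec.subspace H" and x: "x \<in> K"
    and sub: "conic_member x \<subseteq> H" "coord_subspace {h..<2 * h + h div 2} \<subseteq> H"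
  shows "coord_space (2 * h + h div 2) \<subseteq> H"
proof
  fix v :: "nat \<Rightarrow> 'a"
  assume "v \<in> coord_space (2 * h + h div 2)"
  then obtain s t u where stu: "s \<in> K" "t \<in> K" "u \<in> K" "v = join s t u"
    using ex_join_eq by blast
  have "v = join s (s * x) (s * x\<^sup>2) + join 0 (t - s * x) (u - s * x\<^sup>2)"
    unfolding stu(4) by (rule join_decompose_conic) (use stu x in auto)
  also have "\<dots> \<in> H"
    using join_in_conic_member join_0_in_coord_subspace stu(1) sub
    by (intro fvec.subspace_add[OF H]) blast+
  finally show "v \<in> H" .
qed

section \<open>The two members at infinity\<close>

text \<open>
  Both index sets have \<open>h\<close> elements. They share the last \<open>h div 2\<close> coordinates and together
  cover all coordinates from \<open>h\<close> on.
\<close>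

definition member_at_infinity :: "bool \<Rightarrow> (nat \<Rightarrow> 'a) set" where
  "member_at_infinity j = coord_subspace
     ((if j then {h..<2 * h - h div 2} else {h + h div 2..<2 * h}) \<union> {2 * h..<2 * h + h div 2})"

lemma member_at_infinity_subset:
  "coord_subspace {2 * h..<2 * h + h div 2} \<subseteq> member_at_infinity j"
  "member_at_infinity j \<subseteq> coord_subspace {h..<2 * h + h div 2}"
  unfolding member_at_infinity_def by (intro coord_subspace_mono; auto)+

lemma dim_member_at_infinity: "fvec.dim (member_at_infinity j) = h"
proof -
  have "card ((if j then {h..<2 * h - h div 2} else {h + h div 2..<2 * h}) \<union> {2 * h..<2 * h + h div 2})
      = card (if j then {h..<2 * h - h div 2} else {h + h div 2..<2 * h}) + card {2 * h..<2 * h + h div 2}"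
    by (rule card_Un_disjoint) auto
  also have "\<dots> = h"
    by auto
  finally show ?thesis
    by (simp add: member_at_infinity_def dim_coord_subspace)
qed

lemma members_at_infinity_span:
  assumes "fvec.subspace H" "member_at_infinity True \<subseteq> H" "member_at_infinity False \<subseteq> H"
  shows "coord_subspace {h..<2 * h + h div 2} \<subseteq> H"
proof -
  let ?A = "{h..<2 * h - h div 2} \<union> {2 * h..<2 * h + h div 2}"
    and ?B = "{h + h div 2..<2 * h} \<union> {2 * h..<2 * h + h div 2}"
  \<comment> \<open>The middle ranges leave no gap: \<open>h + h div 2\<close> is at most
    \<open>2 * h - h div 2\<close>, because twice \<open>h div 2\<close> is at most
    \<open>h\<close>.\<close>
  have "{h..<2 * h + h div 2} \<subseteq> ?A \<union> ?B"
    by auto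
  then have "coord_subspace {h..<2 * h + h div 2} \<subseteq> (coord_subspace (?A \<union> ?B) :: (nat \<Rightarrow> 'a) set)"
    by (rule coord_subspace_mono)
  also have "\<dots> \<subseteq> H"
    by (rule coord_subspace_Un_subset) (use assms in \<open>simp_all add: member_at_infinity_def\<close>)
  finally show ?thesis .
qed

text \<open>The sum type keeps all indices apart, so the family has \<open>card K + 2\<close>
  members counted with multiplicity.\<close>

definition member :: "'b + bool \<Rightarrow> (nat \<Rightarrow> 'a) set" where
  "member = case_sum conic_member member_at_infinity"

lemma member_simps [simp]: "member (Inl x) = conic_member x" "member (Inr j) = member_at_infinity j"
  by (simp_all add: member_def)

text \<open>Case distinction on how many of the three members are at infinity. One of them supplies
  the last component, both together the last two, and three distinct Boolean indices do not
  exist.\<close>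

lemma three_members_span:
  assumes "i \<in> K <+> UNIV" "j \<in> K <+> UNIV" "k \<in> K <+> UNIV" "i \<noteq> j" "i \<noteq> k" "j \<noteq> k"
    and H: "fvec.subspace H" and "member i \<subseteq> H" "member j \<subseteq> H" "member k \<subseteq> H"
  shows "coord_space (2 * h + h div 2) \<subseteq> H"
proof -
  have two: ?thesis if "x \<in> K" "y \<in> K" "x \<noteq> y" "conic_member x \<subseteq> H" "conic_member y \<subseteq> H"
      "member_at_infinity b \<subseteq> H" for x y b
    using two_conic_members_span[OF H that(1-5)] member_at_infinity_subset(1) that(6) by blast
  have one: ?thesis if "x \<in> K" "b \<noteq> c" "conic_member x \<subseteq> H" "member_at_infinity b \<subseteq> H"
      "member_at_infinity c \<subseteq> H" for x b c
  proof -
    have "member_at_infinity True \<subseteq> H" "member_at_infinity False \<subseteq> H"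
      using that by (cases b; cases c; simp)+
    then show ?thesis
      using one_conic_member_span[OF H that(1,3)] members_at_infinity_span[OF H] by blast
  qed
  have three: ?thesis if "x \<in> K" "y \<in> K" "z \<in> K" "x \<noteq> y" "x \<noteq> z" "y \<noteq> z"
      "conic_member x \<subseteq> H" "conic_member y \<subseteq> H" "conic_member z \<subseteq> H" for x y z
    using three_conic_members_span[OF H that] .
  note prems = assms(1-6,8-10)
  show ?thesis
  proof (cases i; cases j; cases k)
    fix x y z assume "i = Inl x" "j = Inl y" "k = Inl z"
    with prems three[of x y z] show ?thesis by auto
  next
    fix x y c assume "i = Inl x" "j = Inl y" "k = Inr c"
    with prems two[of x y c] show ?thesis by auto
  next
    fix x b z assume "i = Inl x" "j = Inr b" "k = Inl z"
    with prems two[of x z b] show ?thesis by auto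
  next
    fix x b c assume "i = Inl x" "j = Inr b" "k = Inr c"
    with prems one[of x b c] show ?thesis by auto
  next
    fix a y z assume "i = Inr a" "j = Inl y" "k = Inl z"
    with prems two[of y z a] show ?thesis by auto
  next
    fix a y c assume "i = Inr a" "j = Inl y" "k = Inr c"
    with prems one[of y a c] show ?thesis by auto
  next
    fix a b z assume "i = Inr a" "j = Inr b" "k = Inl z"
    with prems one[of z a b] show ?thesis by auto
  next
    fix a b c assume "i = Inr a" "j = Inr b" "k = Inr c"
    with prems show ?thesis by auto
  qed
qed

lemma contained_count_members_le_2:
  assumes "finite K" "is_hyperplane (2 * h + h div 2) H"
  shows "contained_count (image_mset member (mset_set (K <+> UNIV))) H \<le> 2"
proof (rule contained_count_image_mset_set_le_2[OF _ assms(2)])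
  show "finite (K <+> (UNIV :: bool set))"
    using assms(1) by simp
qed (rule three_members_span)

lemma projective_system_members:
  assumes "finite K" "h > 0"
  shows "projective_system h (card K + 2) (2 * h + h div 2) 2 (image_mset member (mset_set (K <+> UNIV)))"
    (is "projective_system h _ ?r 2 ?M")
  unfolding projective_system_def
proof (intro conjI ballI allI impI)
  have fin: "finite (K <+> (UNIV :: bool set))"
    using assms(1) by simp
  show "size ?M = card K + 2"
    using assms(1) by (simp add: card_Plus)
  show "contained_count ?M H \<le> 2" if "is_hyperplane ?r H" for H
    using assms(1) that by (rule contained_count_members_le_2)
  fix U
  assume "U \<in># ?M"
  then obtain i where i: "i \<in> K <+> (UNIV :: bool set)" "U = member i"
    using fin by auto
  show "is_subspace ?r U"
  proof (cases i)
    case (Inl x)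
    then show ?thesis
      using i subspace_conic_member[of x] join_in_coord_space
      by (auto simp: is_subspace_def conic_member_def)
  next
    case (Inr j)
    have "coord_subspace {h..<?r} \<subseteq> (coord_space ?r :: (nat \<Rightarrow> 'a) set)"
      unfolding coord_space_eq_coord_subspace by (rule coord_subspace_mono) auto
    with member_at_infinity_subset(2)[of j] have "member_at_infinity j \<subseteq> coord_space ?r"
      by blast
    then show ?thesis
      using i(2) Inr by (simp add: is_subspace_def member_at_infinity_def subspace_coord_subspace)
  qed
  show "fvec.dim U \<le> h"
    using i by (cases i) (auto simp: dim_conic_member dim_member_at_infinity)
next
  \<comment> \<open>The bound \<open>2\<close> is attained by the hyperplane of vectors with entry
    \<open>0\<close> at position \<open>0\<close>: as \<open>h > 0\<close>, it contains both members
    at infinity.\<close>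
  let ?H = "coord_subspace {1..<2 * h + h div 2} :: (nat \<Rightarrow> 'a) set"
  have hyp: "is_hyperplane ?r ?H"
    using assms(2) unfolding is_hyperplane_def is_subspace_def coord_space_eq_coord_subspace
    by (auto simp: subspace_coord_subspace dim_coord_subspace intro!: coord_subspace_mono)
  have fin: "finite (K <+> (UNIV :: bool set))"
    using assms(1) by simp
  have "contained_count ?M ?H \<le> 2"
    using assms(1) hyp by (rule contained_count_members_le_2)
  moreover have "2 \<le> contained_count ?M ?H"
  proof -
    have "coord_subspace {h..<?r} \<subseteq> ?H"
      using assms(2) by (intro coord_subspace_mono) auto
    then have "Inr ` (UNIV :: bool set) \<subseteq> {i \<in> K <+> UNIV. member i \<subseteq> ?H}"
      using member_at_infinity_subset(2) by fastforce
    then have "card (Inr ` (UNIV :: bool set) :: ('b + bool) set) \<le> card {i \<in> K <+> UNIV. member i \<subseteq> ?H}"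
      using fin by (intro card_mono) auto
    then show ?thesis
      using fin by (simp add: contained_count_def filter_mset_image_mset card_image)
  qed
  ultimately show "\<exists>H. is_hyperplane ?r H \<and> contained_count ?M H = 2"
    using hyp by (intro exI[of _ ?H]) simp
qed

end

section \<open>The bound for \<open>n_max\<close>\<close>

lemma nat_floor_five_halves: "nat \<lfloor>2.5 * real h\<rfloor> = 2 * h + h div 2"
proof -
  have "\<lfloor>2.5 * real h\<rfloor> = int (2 * h + h div 2)"
  proof (cases "even h")
    case True
    then obtain k where "h = 2 * k" ..
    then show ?thesis
      by (simp add: floor_unique)
  next
    case False
    then obtain k where "h = 2 * k + 1" ..
    then show ?thesis
      by (intro floor_unique) simp_all
  qed
  then show ?thesis
    by simp
qed

theorem proposition2:
  fixes q h :: nat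
  assumes "primepow q"
    and "CARD('a::{field,finite}) = q"
    and "h \<ge> 2"
  shows "n_max TYPE('a) (nat \<lfloor>2.5 * real h\<rfloor>) h 2 \<ge> q ^ h + 2"
proof -
  have "primepow CARD('a)" "h > 0"
    using assms by simp_all
  then obtain K and \<psi> :: "'a alg_closure \<Rightarrow> nat \<Rightarrow> 'a"
    where K: "coordinatized_field K to_ac \<psi> h" "card K = CARD('a) ^ h"
    by (rule ex_coordinatized_field)
  interpret coordinatized_field K to_ac \<psi> h
    by (rule K(1))
  \<comment> \<open>An infinite \<open>K\<close> would have cardinality \<open>0\<close>, but
    \<open>CARD('a) ^ h\<close> is positive.\<close>
  have "finite K"
    using K(2) by (metis card.infinite power_not_zero zero_less_card_finite less_numeral_extra(3))
  then show ?thesis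
    using n_max_ge[OF projective_system_members] \<open>h > 0\<close>
    unfolding nat_floor_five_halves by (simp add: K(2) assms(2))
qed

end
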